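(* Suppose that $\varphi$ is a bump function that decays faster than any polynomial. Let $\mathcal P$ be the set of all polynomials from $\mathbb R$ to $\mathbb R$. Then $\mathcal P\subset\mathcal G_{p,\varphi}$ for all $p\in[1,\infty)$.
   Context: Bump function: $\varphi:\mathbb R\to\mathbb R$ with $0<\varphi(z)\le1$ for all $z$, $\varphi$ increasing (nondecreasing) on $(-\infty,0]$, decreasing (nonincreasing) on $(0,\infty)$, and $\lim_{|z|\to\infty}\varphi(z)=0$. It decays faster than any polynomial if $\lim_{|z|\to\infty}|z|^r\varphi(z)=0$ for every $r>0$. Class $\mathcal G_{p,\varphi}$ ($p\in[1,\infty)$, $\varphi$ a bump function): let $\mathcal M$ be the set of signed measures $\mu$ on the Borel sets of $\mathbb R$ with $|\mu|$ $\sigma$-finite, where a signed measure is understood in the $\sigma$-finite sense $d\mu=h\,d|\mu|$ with $|\mu|$ a $\sigma$-finite positive Borel measure and $h:\mathbb R\to\{-1,1\}$ Borel. $\mathcal M_{p,\varphi}$ is the set of $\mu\in\mathcal M$ with $\int_B\varphi\,d|\mu|<\infty$ for all compact $B$ and $\int_{\mathbb R}\varphi^{1+1/p}\,d|\mu|<\infty$. For $\mu\in\mathcal M_{p,\varphi}$ put $g^\mu(x)=\int_{(0,x]}\varphi\,d\mu$ for $x\ge0$ and $g^\mu(x)=\int_{(x,0]}\varphi\,d\mu$ for $x<0$, with $(0,0]=\emptyset$. $\Delta_{p,\varphi}$ is the set of functions $\Delta_A(x)=\sum_{i=1}^\infty\lambda_i\varphi(a_i)\chi_{\{a_i\}}(x)$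 with $A=(a_i)_{i\ge1}\subset\mathbb R$ countable, $a_i\ne a_j$ for $i\ne j$, $\lambda_i\in\mathbb R$ and $\sum_i|\lambda_i|\varphi(a_i)^{1+1/p}<\infty$. Then $\mathcal G_{p,\varphi}$ is the set of all $g=c+g^\mu+\Delta_A$ with $c\in\mathbb R$, $\mu\in\mathcal M_{p,\varphi}$, $\Delta_A\in\Delta_{p,\varphi}$. *)

theory Defs
  imports "HOL-Analysis.Analysis" "HOL-Computational_Algebra.Polynomial"
begin

definition bump_function :: "(real \<Rightarrow> real) \<Rightarrow> bool" where
  "bump_function \<phi> \<longleftrightarrow>
     (\<forall>z. 0 < \<phi> z \<and> \<phi> z \<le> 1) \<and>
     mono_on {..0} \<phi> \<and>
     antimono_on {0<..} \<phi> \<and>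
     (\<phi> \<longlongrightarrow> 0) at_infinity"

definition decays_faster_than_polynomials :: "(real \<Rightarrow> real) \<Rightarrow> bool" where
  "decays_faster_than_polynomials \<phi> \<longleftrightarrow>
     (\<forall>r::real. r > 0 \<longrightarrow> ((\<lambda>z. \<bar>z\<bar> powr r * \<phi> z) \<longlongrightarrow> 0) at_infinity)"

text \<open>
  A signed measure \<open>\<mu>\<close> with \<open>d\<mu> = h d|\<mu>|\<close> is represented by the pair \<open>(|\<mu>|, h)\<close>. Both the positive
  and the negative part may be infinite, so \<open>\<mu>\<close> need not assign a value to every Borel set.
\<close>

type_synonym signed_measure = "real measure \<times> (real \<Rightarrow> real)"

abbreviation abs_measure :: "signed_measure \<Rightarrow> real measure" where
  "abs_measure \<mu> \<equiv> fst \<mu>"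

abbreviation sign_density :: "signed_measure \<Rightarrow> real \<Rightarrow> real" where
  "sign_density \<mu> \<equiv> snd \<mu>"

definition signed_measures :: "signed_measure set" where
  "signed_measures = {\<mu>.
     sets (abs_measure \<mu>) = sets borel \<and>
     sigma_finite_measure (abs_measure \<mu>) \<and>
     sign_density \<mu> \<in> borel_measurable borel \<and>
     range (sign_density \<mu>) \<subseteq> {-1, 1}}"

definition signed_set_integral :: "signed_measure \<Rightarrow> real set \<Rightarrow> (real \<Rightarrow> real) \<Rightarrow> real" where
  "signed_set_integral \<mu> S f = (LINT x:S|abs_measure \<mu>. f x * sign_density \<mu> x)"

definition M_class :: "real \<Rightarrow> (real \<Rightarrow> real) \<Rightarrow> signed_measure set" where
  "M_class p \<phi> = {\<mu> \<in> signed_measures.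
     (\<forall>B. compact B \<longrightarrow> (\<integral>\<^sup>+x\<in>B. ennreal (\<phi> x) \<partial>abs_measure \<mu>) < \<infinity>) \<and>
     (\<integral>\<^sup>+x. ennreal (\<phi> x powr (1 + 1 / p)) \<partial>abs_measure \<mu>) < \<infinity>}"

text \<open>There is deliberately no change of sign on the negative half-line.\<close>

definition g_of_measure :: "(real \<Rightarrow> real) \<Rightarrow> signed_measure \<Rightarrow> real \<Rightarrow> real" where
  "g_of_measure \<phi> \<mu> x =
     (if x \<ge> 0 then signed_set_integral \<mu> {0<..x} \<phi>
      else signed_set_integral \<mu> {x<..0} \<phi>)"

text \<open>
  The points \<open>a\<^sub>i\<close> are indexed from 0. The series has at most one nonzero term for each \<open>x\<close>
  when \<open>a\<close> is injective.
\<close>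

definition Delta_fun :: "(real \<Rightarrow> real) \<Rightarrow> (nat \<Rightarrow> real) \<Rightarrow> (nat \<Rightarrow> real) \<Rightarrow> real \<Rightarrow> real" where
  "Delta_fun \<phi> a l x = (\<Sum>i. l i * \<phi> (a i) * indicator {a i} x)"

definition Delta_class :: "real \<Rightarrow> (real \<Rightarrow> real) \<Rightarrow> (real \<Rightarrow> real) set" where
  "Delta_class p \<phi> = {Delta_fun \<phi> a l | a l.
     inj a \<and> summable (\<lambda>i. \<bar>l i\<bar> * \<phi> (a i) powr (1 + 1 / p))}"

definition G_class :: "real \<Rightarrow> (real \<Rightarrow> real) \<Rightarrow> (real \<Rightarrow> real) set" where
  "G_class p \<phi> = {(\<lambda>x. c + g_of_measure \<phi> \<mu> x + D x) | c \<mu> D.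
     \<mu> \<in> M_class p \<phi> \<and> D \<in> Delta_class p \<phi>}"

definition polynomial_functions :: "(real \<Rightarrow> real) set" where
  "polynomial_functions = range (\<lambda>q :: real poly. poly q)"

end

theory Submission
  imports Defs "HOL-Probability.Sinc_Integral"
begin

text \<open>
  The measure representing a polynomial \<open>q\<close> has total variation \<open>|q'|/\<phi> dx\<close>, with the sign of
  \<open>q'\<close> on the positive and of \<open>-q'\<close> on the negative half-line; the fundamental theorem of
  calculus then gives \<open>q = q(0) + g\<^sup>\<mu>\<close>. The two finiteness conditions become local integrability
  of \<open>|q'|\<close> and integrability of \<open>|q'| \<phi>\<^bsup>1/p\<^esup>\<close>, and the latter holds because \<open>\<phi>\<^bsup>1/p\<^esup>\<close>
  also decays faster than any polynomial.
\<close>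

lemma bump_function_pos: "bump_function \<phi> \<Longrightarrow> 0 < \<phi> x"
  and bump_function_le_1: "bump_function \<phi> \<Longrightarrow> \<phi> x \<le> 1"
  by (simp_all add: bump_function_def)

text \<open>Monotone functions are Borel measurable, so it is enough to treat the two half-lines
  separately. On the positive one \<open>\<phi>\<close> is decreasing, so the argument is applied to
  its negative.\<close>

lemma borel_measurable_bump_function:
  assumes "bump_function \<phi>"
  shows "\<phi> \<in> borel_measurable borel"
proof (rule measurable_piecewise_restrict[of "{{..0}, {0<..}}"])
  have "mono_on {0<..} (\<lambda>x. - \<phi> x)"
    using assms by (auto simp: bump_function_def monotone_on_def)
  then have "(\<lambda>x. - (- \<phi> x)) \<in> borel_measurable (restrict_space borel {0<..})"
    by (intro borel_measurable_uminus borel_measurable_mono_on_fnc)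
  moreover have "\<phi> \<in> borel_measurable (restrict_space borel {..0})"
    using assms by (intro borel_measurable_mono_on_fnc) (simp add: bump_function_def)
  ultimately show "\<phi> \<in> borel_measurable (restrict_space borel \<Omega>)"
    if "\<Omega> \<in> {{..0}, {0<..}}" for \<Omega>
    using that by auto
qed auto

text \<open>Far from the origin the bound is the p-th root of the decay hypothesis; elsewhere the
  power of |x| is bounded and the root of \<open>\<phi>\<close> is at most 1.\<close>

lemma power_times_decaying_powr_bounded:
  assumes "bump_function \<phi>" "decays_faster_than_polynomials \<phi>" "0 < p"
  obtains K where "\<And>x. \<bar>x\<bar> ^ k * \<phi> x powr (1 / p) \<le> K"
proof -
  have root_le_1: "\<phi> x powr (1 / p) \<le> 1" for x
    using bump_function_le_1[OF assms(1), of x] bump_function_pos[OF assms(1), of x] assms(3)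
    by (simp add: powr_le1)
  show thesis
  proof (cases "k = 0")
    case True
    then show thesis
      using root_le_1 by (intro that[of 1]) simp
  next
    case False
    \<comment> \<open>The exponent \<open>p * k\<close> turns into k when the p-th root is taken. It
      is positive, as the decay hypothesis requires, because k is nonzero.\<close>
    then have "((\<lambda>z. \<bar>z\<bar> powr (p * k) * \<phi> z) \<longlongrightarrow> 0) at_infinity"
      using assms unfolding decays_faster_than_polynomials_def by simp
    then have "eventually (\<lambda>z. \<bar>z\<bar> powr (p * k) * \<phi> z < 1) at_infinity"
      by (rule order_tendstoD) simp
    then obtain M where M: "\<And>z. M \<le> \<bar>z\<bar> \<Longrightarrow> \<bar>z\<bar> powr (p * k) * \<phi> z < 1"
      unfolding eventually_at_infinity by auto
    have "\<bar>x\<bar> ^ k * \<phi> x powr (1 / p) \<le> max 1 (\<bar>M\<bar> ^ k)" for x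
    proof (cases "M \<le> \<bar>x\<bar>")
      case True
      have "(\<bar>x\<bar> powr (p * k) * \<phi> x) powr (1 / p) \<le> 1"
        using M[OF True] bump_function_pos[OF assms(1), of x] assms(3) by (intro powr_le1) auto
      moreover have "(\<bar>x\<bar> powr (p * k) * \<phi> x) powr (1 / p) = \<bar>x\<bar> ^ k * \<phi> x powr (1 / p)"
        using bump_function_pos[OF assms(1), of x] assms(3) \<open>k \<noteq> 0\<close>
        \<comment> \<open>At x = 0 both sides vanish, again because k is nonzero; for other x the
          base is positive and real powers agree with natural ones.\<close>
        by (cases "x = 0") (simp_all add: powr_mult powr_powr powr_realpow)
      ultimately show ?thesis by simp
    next
      case False
      then have "\<bar>x\<bar> ^ k * \<phi> x powr (1 / p) \<le> \<bar>M\<bar> ^ k * 1"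
        using root_le_1[of x] by (intro mult_mono power_mono) auto
      then show ?thesis by simp
    qed
    then show thesis by (rule that)
  qed
qed

lemma poly_times_decaying_powr_bounded:
  assumes "bump_function \<phi>" "decays_faster_than_polynomials \<phi>" "0 < p"
  obtains K where "\<And>x. \<bar>poly q x\<bar> * \<phi> x powr (1 / p) \<le> K"
proof -
  \<comment> \<open>Existential form of the monomial bound, from which one constant per exponent can
    be chosen.\<close>
  have "\<exists>K. \<forall>x. \<bar>x\<bar> ^ k * \<phi> x powr (1 / p) \<le> K" for k
    by (rule power_times_decaying_powr_bounded[OF assms, of k]) blast
  then obtain K where K: "\<And>k x. \<bar>x\<bar> ^ k * \<phi> x powr (1 / p) \<le> K k"
    by metis
  have "\<bar>poly q x\<bar> * \<phi> x powr (1 / p) \<le> (\<Sum>i\<le>degree q. \<bar>coeff q i\<bar> * K i)" for x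
  proof -
    have "\<bar>poly q x\<bar> * \<phi> x powr (1 / p) \<le> (\<Sum>i\<le>degree q. \<bar>coeff q i * x ^ i\<bar>) * \<phi> x powr (1 / p)"
      unfolding poly_altdef by (intro mult_right_mono sum_abs) simp
    also have "\<dots> = (\<Sum>i\<le>degree q. \<bar>coeff q i\<bar> * (\<bar>x\<bar> ^ i * \<phi> x powr (1 / p)))"
      by (simp add: sum_distrib_right abs_mult power_abs mult.assoc)
    also have "\<dots> \<le> (\<Sum>i\<le>degree q. \<bar>coeff q i\<bar> * K i)"
      by (intro sum_mono mult_left_mono K) simp
    finally show ?thesis .
  qed
  then show thesis by (rule that)
qed

text \<open>Boundedness for the polynomial (1 + x^2) q(x) gives the integrable majorant K / (1 +
  x^2).\<close>

lemma integrable_poly_times_decaying_powr: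
  assumes "bump_function \<phi>" "decays_faster_than_polynomials \<phi>" "0 < p"
  shows "integrable lborel (\<lambda>x. \<bar>poly q x\<bar> * \<phi> x powr (1 / p))"
proof -
  obtain K where K: "\<And>x. \<bar>poly ([:1, 0, 1:] * q) x\<bar> * \<phi> x powr (1 / p) \<le> K"
    using poly_times_decaying_powr_bounded[OF assms] by blast
  note [measurable] = borel_measurable_bump_function[OF assms(1)]
  have [measurable]: "poly q \<in> borel_measurable borel"
    by (intro borel_measurable_continuous_onI continuous_intros)
  have "einterval (-\<infinity>) \<infinity> = UNIV"
    by (auto simp: einterval_iff)
  then have "integrable lborel (\<lambda>x::real. K * inverse (1 + x\<^sup>2))"
    using integrable_inverse_1_plus_square by (simp add: set_integrable_def)
  then show ?thesis
  proof (rule Bochner_Integration.integrable_bound)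
    show "AE x in lborel. norm (\<bar>poly q x\<bar> * \<phi> x powr (1 / p)) \<le> norm (K * inverse (1 + x\<^sup>2))"
    proof (rule AE_I2)
      fix x :: real
      have pos: "0 < 1 + x\<^sup>2"
        by (simp add: add_pos_nonneg)
      have "\<bar>poly ([:1, 0, 1:] * q) x\<bar> = (1 + x\<^sup>2) * \<bar>poly q x\<bar>"
        using pos by (simp only: poly_mult abs_mult) (simp add: power2_eq_square)
      then have "(1 + x\<^sup>2) * (\<bar>poly q x\<bar> * \<phi> x powr (1 / p)) \<le> K"
        using K[of x] by (simp add: mult.assoc)
      then have "\<bar>poly q x\<bar> * \<phi> x powr (1 / p) \<le> K * inverse (1 + x\<^sup>2)"
        using pos by (simp add: field_simps)
      then show "norm (\<bar>poly q x\<bar> * \<phi> x powr (1 / p)) \<le> norm (K * inverse (1 + x\<^sup>2))"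
        by simp
    qed
  qed simp
qed

text \<open>The equality of truth values multiplies two signs: the sign of q' is kept for x > 0 and
  reversed for x \<le> 0, which makes up for the unoriented integral in \<open>g_of_measure\<close>.
  Zeros of q' still receive a value in {-1, 1}.\<close>

definition poly_signed_measure :: "(real \<Rightarrow> real) \<Rightarrow> real poly \<Rightarrow> signed_measure" where
  "poly_signed_measure \<phi> q =
     (density lborel (\<lambda>x. ennreal (\<bar>poly (pderiv q) x\<bar> / \<phi> x)),
      \<lambda>x. if (0 < x) = (0 \<le> poly (pderiv q) x) then 1 else -1)"

lemma poly_signed_measure_in_M_class:
  assumes "bump_function \<phi>" "decays_faster_than_polynomials \<phi>" "0 < p"
  shows "poly_signed_measure \<phi> q \<in> M_class p \<phi>"
proof -
  let ?f = "poly (pderiv q)"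
  let ?M = "density lborel (\<lambda>x. ennreal (\<bar>?f x\<bar> / \<phi> x))"
  note [measurable] = borel_measurable_bump_function[OF assms(1)]
  note pos = bump_function_pos[OF assms(1)]
  have [measurable]: "?f \<in> borel_measurable borel"
    by (intro borel_measurable_continuous_onI continuous_intros)
  have "poly_signed_measure \<phi> q \<in> signed_measures"
    unfolding signed_measures_def poly_signed_measure_def
    \<comment> \<open>A density with finite values over Lebesgue measure is sigma-finite.\<close>
    by (auto simp: sigma_finite_measure.sigma_finite_iff_density_finite[OF sigma_finite_lborel])
  moreover have "(\<integral>\<^sup>+x\<in>B. ennreal (\<phi> x) \<partial>?M) < \<infinity>" if "compact B" for B
  proof -
    have [measurable]: "B \<in> sets borel"
      using that by (rule borel_compact)
    have "(\<integral>\<^sup>+x\<in>B. ennreal (\<phi> x) \<partial>?M) = (\<integral>\<^sup>+x. ennreal (\<bar>?f x\<bar> / \<phi> x) * (ennreal (\<phi> x) * indicator B x) \<partial>lborel)"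
      by (simp add: nn_integral_density)
    \<comment> \<open>The factor \<open>\<phi>\<close> cancels the denominator of the density; what
      remains is a continuous function on a compact set.\<close>
    also have "\<dots> = (\<integral>\<^sup>+x. ennreal (norm (indicator B x *\<^sub>R ?f x)) \<partial>lborel)"
      by (intro nn_integral_cong)
        (auto simp: ennreal_mult'[symmetric] pos less_imp_le less_imp_neq[OF pos, symmetric]
          split: split_indicator)
    also have "\<dots> < \<infinity>"
    proof -
      have "integrable lborel (\<lambda>x. indicator B x *\<^sub>R ?f x)"
        using that by (intro borel_integrable_compact continuous_intros)
      then show ?thesis
        by (simp add: integrable_iff_bounded)
    qed
    finally show ?thesis .
  qed
  moreover have "(\<integral>\<^sup>+x. ennreal (\<phi> x powr (1 + 1 / p)) \<partial>?M) < \<infinity>"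
  proof -
    have "(\<integral>\<^sup>+x. ennreal (\<phi> x powr (1 + 1 / p)) \<partial>?M)
        = (\<integral>\<^sup>+x. ennreal (\<bar>?f x\<bar> / \<phi> x) * ennreal (\<phi> x powr (1 + 1 / p)) \<partial>lborel)"
      by (simp add: nn_integral_density)
    \<comment> \<open>One power of \<open>\<phi>\<close> cancels, leaving the exponent 1/p covered
      by the integrability lemma.\<close>
    also have "\<dots> = (\<integral>\<^sup>+x. ennreal (norm (\<bar>?f x\<bar> * \<phi> x powr (1 / p))) \<partial>lborel)"
      by (intro nn_integral_cong)
        (simp add: ennreal_mult'[symmetric] pos less_imp_le less_imp_neq[OF pos, symmetric]
          powr_add abs_mult)
    also have "\<dots> < \<infinity>"
      using integrable_poly_times_decaying_powr[OF assms] by (simp only: integrable_iff_bounded)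
    finally show ?thesis .
  qed
  ultimately show ?thesis
    by (simp add: M_class_def poly_signed_measure_def)
qed

lemma LBINT_poly_pderiv:
  fixes q :: "real poly"
  assumes "a \<le> b"
  shows "(LBINT x:{a<..b}. poly (pderiv q) x) = poly q b - poly q a"
proof -
  have "(LBINT x=a..b. poly (pderiv q) x) = poly q b - poly q a"
    by (intro interval_integral_FTC_finite continuous_intros
        DERIV_subset[OF poly_DERIV, THEN has_real_derivative_iff_has_vector_derivative[THEN iffD1]])
      auto
  then show ?thesis
    using assms by (simp add: interval_integral_Ioc)
qed

lemma g_of_poly_signed_measure:
  assumes "bump_function \<phi>"
  shows "g_of_measure \<phi> (poly_signed_measure \<phi> q) x = poly q x - poly q 0"
proof -
  let ?f = "poly (pderiv q)"
  let ?h = "\<lambda>x. if (0 < x) = (0 \<le> ?f x) then 1 else - 1 :: real"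
  note [measurable] = borel_measurable_bump_function[OF assms]
  note pos = bump_function_pos[OF assms]
  have [measurable]: "?f \<in> borel_measurable borel"
    by (intro borel_measurable_continuous_onI continuous_intros)
  have "signed_set_integral (poly_signed_measure \<phi> q) S \<phi> = (LBINT y:S. \<bar>?f y\<bar> * ?h y)"
    if [measurable]: "S \<in> sets borel" for S
    unfolding signed_set_integral_def poly_signed_measure_def set_lebesgue_integral_def fst_conv snd_conv
    using pos
    by (subst integral_density)
      (auto intro!: Bochner_Integration.integral_cong simp: less_imp_le less_imp_neq[symmetric])
  moreover have "(LBINT y:{0<..x}. \<bar>?f y\<bar> * ?h y) = (LBINT y:{0<..x}. ?f y)"
    by (intro set_lebesgue_integral_cong) auto
  \<comment> \<open>The reversed sign yields -q' on all of (x, 0], the endpoint 0 included, so the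
    integral is -(q(0) - q(x)) = q(x) - q(0).\<close>
  moreover have "(LBINT y:{x<..0}. \<bar>?f y\<bar> * ?h y) = - (LBINT y:{x<..0}. ?f y)"
    unfolding set_integral_uminus[symmetric] set_lebesgue_integral_def integral_minus[symmetric]
    by (intro Bochner_Integration.integral_cong) (auto split: split_indicator)
  ultimately show ?thesis
    by (simp add: g_of_measure_def LBINT_poly_pderiv)
qed

text \<open>Polynomials get a trivial jump part. With all coefficients zero any injective sequence
  of points serves, here the natural numbers.\<close>

lemma zero_in_Delta_class: "(\<lambda>x. 0) \<in> Delta_class p \<phi>"
proof -
  have "Delta_fun \<phi> real (\<lambda>_. 0) = (\<lambda>x. 0)"
    by (simp add: Delta_fun_def fun_eq_iff)
  moreover have "inj real \<and> summable (\<lambda>i. \<bar>0\<bar> * \<phi> (real i) powr (1 + 1 / p))"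
    by simp
  ultimately show ?thesis
    unfolding Delta_class_def by (intro CollectI exI[of _ real] exI[of _ "\<lambda>_. 0"]) simp
qed

theorem theorem6p3:
  fixes \<phi> :: "real \<Rightarrow> real"
  assumes "bump_function \<phi>"
    and "decays_faster_than_polynomials \<phi>"
  shows "\<forall>p::real. 1 \<le> p \<longrightarrow> polynomial_functions \<subseteq> G_class p \<phi>"
proof (intro allI impI subsetI)
  fix p :: real and f
  assume "1 \<le> p" "f \<in> polynomial_functions"
  then obtain q where "f = poly q"
    by (auto simp: polynomial_functions_def)
  then have "f = (\<lambda>x. poly q 0 + g_of_measure \<phi> (poly_signed_measure \<phi> q) x + 0)"
    by (simp add: g_of_poly_signed_measure[OF assms(1)])
  moreover have "poly_signed_measure \<phi> q \<in> M_class p \<phi>"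
    using \<open>1 \<le> p\<close> by (intro poly_signed_measure_in_M_class assms) simp
  ultimately show "f \<in> G_class p \<phi>"
    unfolding G_class_def using zero_in_Delta_class[of p \<phi>]
    by (intro CollectI exI[of _ "poly q 0"] exI[of _ "poly_signed_measure \<phi> q"] exI[of _ "\<lambda>x. 0"]) auto
qed

end
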